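(* Let $X$ be a non-negative random variable with $\mathbb{E}[X]=m$, $m>0$, and $\mathbb{E}[X^2]<\infty$. Let $X^e$ be a random variable, defined on the same probability space as $X$, having the equilibrium distribution with respect to $X$, and let $\mathbf{e}$ be a standard exponential random variable. Then $$d_W(X,\mathbf{e})\leq 2\,\mathbb{E}\big[|X-X^e|\big]+|m-1|.$$
   Context: For a non-negative random variable $X$ with positive finite mean, a random variable $X^e$ has the equilibrium distribution with respect to $X$ if for every Lipschitz function $f:\mathbb{R}\to\mathbb{R}$ (with a.e. derivative $f'$), $$\mathbb{E}[f'(X^e)]=\frac{\mathbb{E}[f(X)-f(0)]}{\mathbb{E}[X]}.$$ The joint law of $(X,X^e)$ is otherwise arbitrary. The Wasserstein distance between probability measures $\mu,\nu$ on $\mathbb{R}$ is $d_W(\mu,\nu)=\sup_{f\in\mathcal{F}}\left|\int f\,d\mu-\int f\,d\nu\right|$, where $\mathcal{F}$ is the set of Lipschitz functions $f:\mathbb{R}\to\mathbb{R}$ with $\|f'\|_\infty\leq1$; $d_W(X,Y)$ for random variables means the distance of their laws. *)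

theory Defs
  imports "HOL-Probability.Probability"
begin

definition lipschitz_fun :: "(real \<Rightarrow> real) \<Rightarrow> bool" where
  "lipschitz_fun f \<longleftrightarrow> (\<exists>C. C-lipschitz_on UNIV f)"

(* f' is a version of the almost everywhere derivative of f; Borel measurability of f' makes
   f'(Y) a random variable for every real random variable Y. *)
definition ae_deriv :: "(real \<Rightarrow> real) \<Rightarrow> (real \<Rightarrow> real) \<Rightarrow> bool" where
  "ae_deriv f f' \<longleftrightarrow> f' \<in> borel_measurable borel \<and>
     (AE x in lborel. (f has_real_derivative f' x) (at x))"

(* Intended for X non-negative with positive finite mean.  The identity is required for every
   version f' of the a.e. derivative: E[f'(Xe)] is meant not to depend on the version.  This
   forces the law of Xe to be absolutely continuous, so f'(Xe) is almost surely bounded and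
   the integral on the left always exists. *)
definition has_equilibrium_distribution ::
    "'a measure \<Rightarrow> ('a \<Rightarrow> real) \<Rightarrow> ('a \<Rightarrow> real) \<Rightarrow> bool" where
  "has_equilibrium_distribution M X Xe \<longleftrightarrow>
     (\<forall>f f'. lipschitz_fun f \<and> ae_deriv f f' \<longrightarrow>
        (\<integral>\<omega>. f' (Xe \<omega>) \<partial>M) = (\<integral>\<omega>. f (X \<omega>) - f 0 \<partial>M) / (\<integral>\<omega>. X \<omega> \<partial>M))"

(* All versions of the a.e. derivative have the same essential supremum, and one exists for
   every Lipschitz f by Rademacher's theorem, so the existential quantifier is harmless. *)
definition wasserstein_test :: "(real \<Rightarrow> real) set" where
  "wasserstein_test = {f. lipschitz_fun f \<and>
     (\<exists>f'. ae_deriv f f' \<and> esssup lborel (\<lambda>x. ereal \<bar>f' x\<bar>) \<le> 1)}"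

(* Intended for probability measures on the Borel sets of the reals with finite first moment,
   for which all test functions are integrable.  The supremum is taken in [0, \<infinity>]. *)
definition wasserstein_dist :: "real measure \<Rightarrow> real measure \<Rightarrow> ennreal" where
  "wasserstein_dist \<mu> \<nu> =
     (SUP f\<in>wasserstein_test. ennreal \<bar>(\<integral>x. f x \<partial>\<mu>) - (\<integral>x. f x \<partial>\<nu>)\<bar>)"

end

theory Submission
  imports Defs
begin

text \<open>
  Stein's method. For a test function \<open>h\<close> put \<open>G x = E[h(x + e)]\<close>. Then \<open>G\<close> is again 1-Lipschitz and
  \<open>G' = G - h\<close>, so \<open>D = G'\<close> is bounded by 1 and 2-Lipschitz. The equilibrium identity
  for \<open>G\<close> reads \<open>E[G(X)] - G(0) = m E[D(Xe)]\<close>, hence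
  \<open>E[h(X)] - E[h(e)] = E[G(X) - D(X)] - G(0) = E[D(Xe) - D(X)] + (m - 1) E[D(Xe)]\<close>.
  The second moment of \<open>X\<close> makes \<open>Xe\<close> integrable; otherwise the Bochner integral of
  \<open>\<bar>X - Xe\<bar>\<close> would be the junk value 0.
\<close>

section \<open>Lipschitz functions and antiderivatives on the real line\<close>

lemma borel_measurable_lipschitz:
  fixes h :: "real \<Rightarrow> real"
  assumes "L-lipschitz_on UNIV h"
  shows "h \<in> borel_measurable borel"
  using lipschitz_on_continuous_on[OF assms] by (rule borel_measurable_continuous_onI)

lemma (in prob_space) integrable_lipschitz:
  fixes h :: "real \<Rightarrow> real" and X :: "'a \<Rightarrow> real"
  assumes "L-lipschitz_on UNIV h" and [measurable]: "integrable M X"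
  shows "integrable M (\<lambda>\<omega>. h (X \<omega>))"
proof (rule Bochner_Integration.integrable_bound)
  have [measurable]: "h \<in> borel_measurable borel"
    using assms(1) by (rule borel_measurable_lipschitz)
  show "(\<lambda>\<omega>. h (X \<omega>)) \<in> borel_measurable M"
    by measurable
  show "integrable M (\<lambda>\<omega>. \<bar>h 0\<bar> + L * \<bar>X \<omega>\<bar>)"
    using assms(2) by simp
  have "\<bar>h x\<bar> \<le> \<bar>h 0\<bar> + L * \<bar>x\<bar>" for x
    using lipschitz_onD[OF assms(1), of x 0] by (simp add: dist_real_def)
  then show "AE \<omega> in M. norm (h (X \<omega>)) \<le> norm (\<bar>h 0\<bar> + L * \<bar>X \<omega>\<bar>)"
    using lipschitz_on_nonneg[OF assms(1)] by simp
qed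

text \<open>Working on the whole line gives a derivative at every point, so shifts and half-lines
  need no care about interval ends.\<close>

lemma continuous_antiderivative:
  fixes f :: "real \<Rightarrow> real"
  assumes "\<And>x. isCont f x"
  obtains F where "\<And>x. (F has_real_derivative f x) (at x)"
  using einterval_antiderivative[of "-\<infinity>" "\<infinity>" f] assms
  by (auto simp: has_real_derivative_iff_has_vector_derivative)

lemma lipschitz_of_bounded_derivative:
  fixes f :: "real \<Rightarrow> real"
  assumes "\<And>x. (f has_real_derivative f' x) (at x)" and "\<And>x. \<bar>f' x\<bar> \<le> C"
  shows "C-lipschitz_on UNIV f"
proof (rule lipschitz_onI)
  show "0 \<le> C"
    using assms(2)[of 0] by linarith
  show "dist (f x) (f y) \<le> C * dist x y" for x y
    using field_differentiable_bound[of UNIV f f' C x y] assms by (simp add: dist_norm)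
qed

lemma lipschitz_isCont:
  fixes h :: "real \<Rightarrow> real"
  assumes "L-lipschitz_on UNIV h"
  shows "isCont h x"
  using lipschitz_on_continuous_on[OF assms] by (simp add: continuous_on_eq_continuous_at)

section \<open>Almost everywhere derivatives and the test functions\<close>

text \<open>Dominated convergence for the difference quotients of \<open>f\<close> gives the fundamental theorem
  of calculus.\<close>

lemma lipschitz_integral_ae_deriv:
  assumes lip: "C-lipschitz_on UNIV f" and deriv: "ae_deriv f f'" and "a \<le> b"
  shows "integrable lborel (\<lambda>x. f' x * indicator {a..b} x)"
    and "(\<integral>x. f' x * indicator {a..b} x \<partial>lborel) = f b - f a"
proof -
  have [measurable]: "f \<in> borel_measurable borel" "f' \<in> borel_measurable borel"
    using borel_measurable_lipschitz[OF lip] deriv by (auto simp: ae_deriv_def)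
  \<comment> \<open>Dominated convergence works along a sequence, so the step of the difference
    quotients is a positive null sequence.\<close>
  define d where "d n = inverse (real (Suc n))" for n
  have d_pos: "d n > 0" for n
    by (simp add: d_def)
  have d_lim: "filterlim d (at 0) sequentially"
    unfolding filterlim_at using LIMSEQ_inverse_real_of_nat by (auto simp: d_def[abs_def])
  define q where "q n x = (f (x + d n) - f x) / d n" for n x
  have [measurable]: "q n \<in> borel_measurable borel" for n
    unfolding q_def[abs_def] by measurable
  have q_lim: "(\<lambda>n. q n x) \<longlonglongrightarrow> D" if "(f has_real_derivative D) (at x)" for x D
    using filterlim_compose[OF that[unfolded DERIV_def] d_lim] by (simp add: q_def)
  have q_bound: "\<bar>q n x\<bar> \<le> C" for n x
    using lipschitz_onD[OF lip, of "x + d n" x] d_pos[of n]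
    by (simp add: q_def dist_real_def divide_le_eq)
  have AE_lim: "AE x in lborel. (\<lambda>n. q n x * indicator {a..b} x) \<longlonglongrightarrow> f' x * indicator {a..b} x"
    using deriv unfolding ae_deriv_def by (auto intro!: tendsto_mult_right q_lim)
  have AE_bound: "AE x in lborel. norm (q n x * indicator {a..b} x) \<le> C * indicator {a..b} x" for n
    using q_bound by (auto split: split_indicator)
  have int_bound: "integrable lborel (\<lambda>x. C * indicator {a..b} x)"
    using \<open>a \<le> b\<close> by (intro integrable_mult_right integrable_real_indicator) auto
  show "integrable lborel (\<lambda>x. f' x * indicator {a..b} x)"
    by (rule integrable_dominated_convergence[OF _ _ int_bound AE_lim AE_bound]) measurable
  have lim: "(\<lambda>n. \<integral>x. q n x * indicator {a..b} x \<partial>lborel)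
      \<longlonglongrightarrow> (\<integral>x. f' x * indicator {a..b} x \<partial>lborel)"
    by (rule integral_dominated_convergence[OF _ _ int_bound AE_lim AE_bound]) measurable
  \<comment> \<open>With \<open>F\<close> an antiderivative of \<open>f\<close>, the difference
    quotient of \<open>F\<close> with step \<open>d n\<close> is an antiderivative of
    \<open>q n\<close>. The integral of \<open>q n\<close> is thus the difference of two such
    quotients, which tend to \<open>f b\<close> and \<open>f a\<close>.\<close>
  note cont = lipschitz_isCont[OF lip]
  obtain F where F: "\<And>x. (F has_real_derivative f x) (at x)"
    using continuous_antiderivative[OF cont] by metis
  have F_lim: "(\<lambda>n. (F (x + d n) - F x) / d n) \<longlonglongrightarrow> f x" for x
    using filterlim_compose[OF F[of x, unfolded DERIV_def] d_lim] by simp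
  have "(\<integral>x. q n x * indicator {a..b} x \<partial>lborel)
      = (F (b + d n) - F b) / d n - (F (a + d n) - F a) / d n" for n
  proof (rule integral_FTC_Icc_real[OF \<open>a \<le> b\<close>])
    show "((\<lambda>x. (F (x + d n) - F x) / d n) has_real_derivative q n x) (at x)" for x
      unfolding q_def
      by (intro DERIV_cdivide DERIV_diff F DERIV_shift[THEN iffD1])
    have "isCont (\<lambda>x. f (x + d n)) x" for x
      by (rule isCont_o2[OF _ cont]) simp
    then show "isCont (q n) x" for x
      unfolding q_def[abs_def] using cont d_pos[of n] by (intro continuous_intros) auto
  qed
  then have "(\<lambda>n. \<integral>x. q n x * indicator {a..b} x \<partial>lborel) \<longlonglongrightarrow> f b - f a"
    using tendsto_diff[OF F_lim[of b] F_lim[of a]] by simp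
  then show "(\<integral>x. f' x * indicator {a..b} x \<partial>lborel) = f b - f a"
    using lim LIMSEQ_unique by blast
qed

text \<open>The constant in \<open>lipschitz_fun\<close> is arbitrary; it serves to write increments
  as integrals of the derivative. The essential bound on the derivative then sharpens it to
  1.\<close>

lemma wasserstein_test_lipschitz:
  assumes "h \<in> wasserstein_test"
  shows "1-lipschitz_on UNIV h"
proof -
  obtain C h' where C: "C-lipschitz_on UNIV h" and h': "ae_deriv h h'"
      and sup: "esssup lborel (\<lambda>x. ereal \<bar>h' x\<bar>) \<le> 1"
    using assms by (auto simp: wasserstein_test_def lipschitz_fun_def)
  have bound: "AE x in lborel. \<bar>h' x\<bar> \<le> 1"
    using esssup_AE[of "\<lambda>x. ereal \<bar>h' x\<bar>" lborel]
  proof eventually_elim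
    case (elim x)
    then show ?case
      using sup by (metis order_trans ereal_less_eq(3) one_ereal_def)
  qed
  show ?thesis
  proof (rule lipschitz_on_leI)
    fix a b :: real
    assume "a \<le> b"
    note FTC = lipschitz_integral_ae_deriv[OF C h' \<open>a \<le> b\<close>]
    have "\<bar>h b - h a\<bar> \<le> (\<integral>x. \<bar>h' x * indicator {a..b} x\<bar> \<partial>lborel)"
      unfolding FTC(2)[symmetric] by (rule integral_abs_bound)
    also have "\<dots> \<le> (\<integral>x. indicator {a..b} x \<partial>lborel)"
    proof (rule integral_mono_AE)
      show "AE x in lborel. \<bar>h' x * indicator {a..b} x\<bar> \<le> indicator {a..b} x"
        using bound by eventually_elim (simp split: split_indicator)
    qed (use FTC(1) \<open>a \<le> b\<close> in \<open>auto intro!: integrable_real_indicator\<close>)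
    also have "\<dots> = b - a"
      using \<open>a \<le> b\<close> by simp
    finally show "dist (h a) (h b) \<le> 1 * dist a b"
      using \<open>a \<le> b\<close> by (simp add: dist_real_def)
  qed simp
qed

section \<open>Exponential smoothing and its differential equation\<close>

text \<open>The substitution \<open>t = x + s\<close> turns the expectation into
  \<open>exp x * (\<integral>t\<ge>x. exp (- t) * h t)\<close>.\<close>

lemma (in prob_space) exponential_shift_derivative:
  fixes e :: "'a \<Rightarrow> real"
  assumes D: "distributed M lborel e (exponential_density 1)" and lip: "L-lipschitz_on UNIV h"
  shows "((\<lambda>x. expectation (\<lambda>\<omega>. h (x + e \<omega>))) has_real_derivative
           expectation (\<lambda>\<omega>. h (x + e \<omega>)) - h x) (at x)"
proof -
  define G where "G x = expectation (\<lambda>\<omega>. h (x + e \<omega>))" for x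
  define g where "g t = exp (- t) * h t" for t
  have [measurable]: "h \<in> borel_measurable borel"
    using lip by (rule borel_measurable_lipschitz)
  have cont_g: "isCont g x" for x
    unfolding g_def[abs_def] by (intro continuous_intros lipschitz_isCont[OF lip])
  \<comment> \<open>The exponential density is the Erlang density of index 0, and the final 1
    selects the first moment.\<close>
  have int_e: "integrable M e"
    using erlang_ith_moment_integrable[of 1 e 0 1] D by simp
  have int: "integrable M (\<lambda>\<omega>. h (x + e \<omega>))" for x
    by (rule integrable_lipschitz[OF lip]) (use int_e in simp)
  \<comment> \<open>After the shift, \<open>x\<close> enters only through the factor
    \<open>exp x\<close> and the lower limit of integration.\<close>
  have dens: "exponential_density 1 (t - x) * h t = exp x * (indicator {x..} t *\<^sub>R g t)" for x t
    by (simp add: exponential_density_def g_def exp_diff exp_minus field_simps split: split_indicator)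
  have int_g: "set_integrable lborel {x..} g" for x
  proof -
    have "integrable lborel (\<lambda>s. exponential_density 1 s * h (x + s))"
      using int[of x] D by (subst distributed_integrable) (auto simp: exponential_density_nonneg)
    from lborel_integrable_real_affine[OF this, of 1 "- x"]
    show ?thesis
      by (simp add: dens set_integrable_def)
  qed
  have G: "G x = exp x * (LINT t:{x..}|lborel. g t)" for x
  proof -
    have "G x = (\<integral>s. exponential_density 1 s * h (x + s) \<partial>lborel)"
      unfolding G_def using D
      by (subst distributed_integral) (auto simp: exponential_density_nonneg)
    also have "\<dots> = (\<integral>t. exponential_density 1 (t - x) * h t \<partial>lborel)"
      by (subst lborel_integral_real_affine[of 1 _ "- x"]) auto
    finally show ?thesis
      by (simp add: dens set_lebesgue_integral_def)
  qed
  obtain H where H: "\<And>x. (H has_real_derivative g x) (at x)"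
    using continuous_antiderivative[OF cont_g] by metis
  \<comment> \<open>The tail integral plus an antiderivative of \<open>g\<close> is constant, so the
    tail integral is differentiable in its lower limit with derivative \<open>- g\<close>.\<close>
  have diff: "(LINT t:{x..}|lborel. g t) + H x = (LINT t:{y..}|lborel. g t) + H y"
    if "x \<le> y" for x y
  proof -
    have Icc: "(LINT t:{x..y}|lborel. g t) = H y - H x"
      using integral_FTC_Icc_real[OF that H cont_g]
      by (simp add: set_lebesgue_integral_def mult.commute)
    \<comment> \<open>The ray is open at \<open>y\<close> to make the union disjoint; the endpoint
      is a null set and is restored below.\<close>
    have "{x..} = {x..y} \<union> {y<..}" "{x..y} \<inter> {y<..} = {}"
      using that by auto
    then have "(LINT t:{x..}|lborel. g t)
        = (LINT t:{x..y}|lborel. g t) + (LINT t:{y<..}|lborel. g t)"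
      using set_integrable_subset[OF int_g[of x]] by (simp add: set_integral_Un)
    also have "(LINT t:{y<..}|lborel. g t) = (LINT t:{y..}|lborel. g t)"
      unfolding set_lebesgue_integral_def
    proof (rule integral_cong_AE)
      show "AE t in lborel. indicator {y<..} t *\<^sub>R g t = indicator {y..} t *\<^sub>R g t"
        using AE_lborel_singleton[of y] by eventually_elim (simp split: split_indicator)
    qed (simp_all add: g_def)
    finally show ?thesis
      using Icc by simp
  qed
  define c where "c = (LINT t:{0..}|lborel. g t) + H 0"
  have "(LINT t:{x..}|lborel. g t) = c - H x" for x
    \<comment> \<open>One of the two orders of 0 and \<open>x\<close> always holds.\<close>
    using diff[of 0 x] diff[of x 0] unfolding c_def by linarith
  then have G_eq: "G x = exp x * (c - H x)" for x
    using G by simp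
  \<comment> \<open>Product rule, with \<open>exp x * g x = h x\<close>.\<close>
  have "((\<lambda>x. exp x * (c - H x)) has_real_derivative exp x * (c - H x) - h x) (at x)"
    by (auto intro!: derivative_eq_intros H simp: g_def exp_minus algebra_simps)
  then have "(G has_real_derivative G x - h x) (at x)"
    unfolding G_eq[abs_def] .
  then show ?thesis
    unfolding G_def .
qed

section \<open>Integrability of the equilibrium variable\<close>

text \<open>The defining identity for a function with derivative \<open>min \<bar>x\<bar> n\<close> bounds the truncated
  means of \<open>\<bar>Xe\<bar>\<close> uniformly in \<open>n\<close>.\<close>

lemma (in prob_space) integrable_equilibrium:
  fixes X Xe :: "'a \<Rightarrow> real"
  assumes [measurable]: "X \<in> borel_measurable M" "Xe \<in> borel_measurable M"
    and int: "integrable M X" and mean: "0 < expectation X"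
    and square: "integrable M (\<lambda>\<omega>. (X \<omega>)\<^sup>2)"
    and eq: "has_equilibrium_distribution M X Xe"
  shows "integrable M Xe"
proof -
  define m where "m = expectation X"
  define B where "B = expectation (\<lambda>\<omega>. (X \<omega>)\<^sup>2) / m"
  have trunc_int: "integrable M (\<lambda>\<omega>. min \<bar>Xe \<omega>\<bar> (real n))" for n
    by (rule integrable_const_bound[of _ "real n"]) auto
  have bound: "expectation (\<lambda>\<omega>. min \<bar>Xe \<omega>\<bar> (real n)) \<le> B" for n
  proof -
    \<comment> \<open>The absolute value avoids a separate proof that \<open>Xe\<close> is almost
      surely non-negative. The truncation keeps the antiderivative of \<open>r\<close> Lipschitz, as
      the identity demands.\<close>
    define r where "r x = min \<bar>x\<bar> (real n)" for x
    have "isCont r x" for x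
      unfolding r_def[abs_def] by (intro continuous_intros)
    then obtain f where f: "\<And>x. (f has_real_derivative r x) (at x)"
      using continuous_antiderivative by metis
    have r_le: "\<bar>r x\<bar> \<le> real n" for x
      by (simp add: r_def)
    have lip: "(real n)-lipschitz_on UNIV f"
      by (rule lipschitz_of_bounded_derivative[OF f r_le])
    have "ae_deriv f r"
      using f by (auto simp: ae_deriv_def r_def[abs_def])
    then have E: "expectation (\<lambda>\<omega>. r (Xe \<omega>)) = expectation (\<lambda>\<omega>. f (X \<omega>) - f 0) / m"
      using eq lip unfolding has_equilibrium_distribution_def lipschitz_fun_def m_def by blast
    have f_le: "f x - f 0 \<le> x\<^sup>2" for x
    proof -
      \<comment> \<open>Mean value bound on a symmetric interval, where \<open>r\<close> is at most
        \<open>\<bar>x\<bar>\<close>. The sharper \<open>x\<^sup>2 / 2\<close> would only halve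
        \<open>B\<close>, and just its finiteness matters.\<close>
      have "norm (f x - f 0) \<le> \<bar>x\<bar> * norm (x - 0)"
        by (rule field_differentiable_bound[of "{-\<bar>x\<bar>..\<bar>x\<bar>}" f r])
           (use has_field_derivative_at_within[OF f] in \<open>auto simp: r_def\<close>)
      then show ?thesis
        by (simp add: power2_eq_square flip: abs_mult)
    qed
    have "expectation (\<lambda>\<omega>. f (X \<omega>) - f 0) \<le> expectation (\<lambda>\<omega>. (X \<omega>)\<^sup>2)"
      using f_le integrable_lipschitz[OF lip int] square by (intro integral_mono) auto
    then show ?thesis
      using mean E by (simp add: r_def B_def m_def divide_right_mono)
  qed
  have trunc_le: "min \<bar>x\<bar> (real n) \<le> min \<bar>x\<bar> (real k)" if "n \<le> k" for x n k
    using that by simp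
  have "incseq (\<lambda>n. expectation (\<lambda>\<omega>. min \<bar>Xe \<omega>\<bar> (real n)))"
    unfolding incseq_def using trunc_le trunc_int by (auto intro!: integral_mono)
  then obtain l where l: "(\<lambda>n. expectation (\<lambda>\<omega>. min \<bar>Xe \<omega>\<bar> (real n))) \<longlonglongrightarrow> l"
    using incseq_convergent[of _ B] bound by metis
  have "integrable M (\<lambda>\<omega>. \<bar>Xe \<omega>\<bar>)"
  proof (rule integral_monotone_convergence_nonneg[OF trunc_int _ _ _ l])
    show "AE \<omega> in M. mono (\<lambda>n. min \<bar>Xe \<omega>\<bar> (real n))"
      using trunc_le by (auto simp: mono_def)
    have "\<forall>\<^sub>F n in sequentially. min \<bar>x\<bar> (real n) = \<bar>x\<bar>" for x
      using eventually_ge_at_top[of "nat \<lceil>\<bar>x\<bar>\<rceil>"] by eventually_elim linarith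
    then show "AE \<omega> in M. (\<lambda>n. min \<bar>Xe \<omega>\<bar> (real n)) \<longlonglongrightarrow> \<bar>Xe \<omega>\<bar>"
      by (intro AE_I2 tendsto_eventually)
  qed auto
  then show ?thesis
    by (subst (asm) integrable_abs_iff) auto
qed

section \<open>The Wasserstein bound\<close>

theorem theorem3p5:
  fixes M :: "'a measure" and N :: "'b measure"
    and X Xe :: "'a \<Rightarrow> real" and e :: "'b \<Rightarrow> real" and m :: real
  assumes "prob_space M"
    and "X \<in> borel_measurable M"
    and "AE \<omega> in M. 0 \<le> X \<omega>"
    and "integrable M X"
    and "(\<integral>\<omega>. X \<omega> \<partial>M) = m"
    and "0 < m"
    and "integrable M (\<lambda>\<omega>. (X \<omega>)\<^sup>2)"
    and "Xe \<in> borel_measurable M"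
    and "has_equilibrium_distribution M X Xe"
    and "prob_space N"
    and "distributed N lborel e (exponential_density 1)"
  shows "wasserstein_dist (distr M borel X) (distr N borel e)
           \<le> ennreal (2 * (\<integral>\<omega>. \<bar>X \<omega> - Xe \<omega>\<bar> \<partial>M) + \<bar>m - 1\<bar>)"
  unfolding wasserstein_dist_def
proof (intro SUP_least ennreal_leI)
  fix h :: "real \<Rightarrow> real"
  assume "h \<in> wasserstein_test"
  then have h: "1-lipschitz_on UNIV h"
    by (rule wasserstein_test_lipschitz)
  interpret M: prob_space M by fact
  interpret N: prob_space N by fact
  note [measurable] = assms(2) assms(8) borel_measurable_lipschitz[OF h]
  have [measurable]: "e \<in> borel_measurable N"
    using distributed_measurable[OF assms(11)] by simp
  have int_e: "integrable N e"
    using N.erlang_ith_moment_integrable[of 1 e 0 1] assms(11) by simp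
  have int_Xe: "integrable M Xe"
    using M.integrable_equilibrium[OF assms(2,8,4) _ assms(7,9)] assms(5,6) by simp
  define G where "G x = (\<integral>\<omega>. h (x + e \<omega>) \<partial>N)" for x
  have G_deriv: "(G has_real_derivative G x - h x) (at x)" for x
    unfolding G_def by (rule N.exponential_shift_derivative[OF assms(11) h])
  have int_h: "integrable N (\<lambda>\<omega>. h (x + e \<omega>))" for x
    by (rule N.integrable_lipschitz[OF h]) (use int_e in simp)
  have G: "1-lipschitz_on UNIV G"
  proof (rule lipschitz_onI)
    fix x y :: real
    have "\<bar>G x - G y\<bar> = \<bar>\<integral>\<omega>. h (x + e \<omega>) - h (y + e \<omega>) \<partial>N\<bar>"
      unfolding G_def using int_h by simp
    also have "\<dots> \<le> (\<integral>\<omega>. \<bar>h (x + e \<omega>) - h (y + e \<omega>)\<bar> \<partial>N)"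
      by (rule integral_abs_bound)
    also have "\<dots> \<le> (\<integral>\<omega>. \<bar>x - y\<bar> \<partial>N)"
    proof (rule integral_mono)
      show "\<bar>h (x + e \<omega>) - h (y + e \<omega>)\<bar> \<le> \<bar>x - y\<bar>" for \<omega>
        using lipschitz_onD[OF h, of "x + e \<omega>" "y + e \<omega>"] by (simp add: dist_real_def)
    qed (use int_h in auto)
    finally show "dist (G x) (G y) \<le> 1 * dist x y"
      by (simp add: dist_real_def N.prob_space)
  qed simp
  define D where "D x = G x - h x" for x
  note G_meas [measurable] = borel_measurable_lipschitz[OF G]
  \<comment> \<open>\<open>D\<close> is the derivative of the 1-Lipschitz \<open>G\<close>; this
    bound gives \<open>\<bar>m - 1\<bar>\<close> its coefficient 1.\<close>
  have D_bound: "\<bar>D x\<bar> \<le> 1" for x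
  proof -
    have "(\<lambda>y. (G (x + y) - G x) / y) \<midarrow>0\<rightarrow> D x"
      using G_deriv[of x] by (simp add: DERIV_def D_def)
    then have "(\<lambda>y. \<bar>(G (x + y) - G x) / y\<bar>) \<midarrow>0\<rightarrow> \<bar>D x\<bar>"
      by (rule tendsto_rabs)
    moreover have "\<bar>(G (x + y) - G x) / y\<bar> \<le> 1" for y
      using lipschitz_onD[OF G, of "x + y" x] by (cases "y = 0") (auto simp: dist_real_def)
    ultimately show ?thesis
      by (intro tendsto_upperbound[of _ _ "at 0"]) auto
  qed
  \<comment> \<open>The factor 2 of the theorem arises here, as the sum of the Lipschitz constants
    of \<open>G\<close> and \<open>h\<close>.\<close>
  have D_lip: "\<bar>D x - D y\<bar> \<le> 2 * \<bar>x - y\<bar>" for x y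
    using lipschitz_onD[OF G UNIV_I UNIV_I, of x y] lipschitz_onD[OF h UNIV_I UNIV_I, of x y]
    unfolding D_def dist_real_def by linarith
  have "ae_deriv G D"
    using G_deriv by (auto simp: ae_deriv_def D_def[abs_def])
  then have stein: "(\<integral>\<omega>. D (Xe \<omega>) \<partial>M) = (\<integral>\<omega>. G (X \<omega>) - G 0 \<partial>M) / m"
    using assms(5,9) G unfolding has_equilibrium_distribution_def lipschitz_fun_def by blast
  have int_D: "integrable M (\<lambda>\<omega>. D (Y \<omega>))" if [measurable]: "Y \<in> borel_measurable M" for Y
    by (rule M.integrable_const_bound[of _ 1]) (use D_bound in \<open>auto simp: D_def\<close>)
  note int_DX = int_D[OF assms(2)] and int_DXe = int_D[OF assms(8)]
  have int_hX: "integrable M (\<lambda>\<omega>. h (X \<omega>))" and int_GX: "integrable M (\<lambda>\<omega>. G (X \<omega>))"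
    using M.integrable_lipschitz[OF h assms(4)] M.integrable_lipschitz[OF G assms(4)] .
  \<comment> \<open>At the origin the shift vanishes, so \<open>G 0\<close> is the mean of
    \<open>h\<close> under the exponential law.\<close>
  have "(\<integral>x. h x \<partial>distr M borel X) - (\<integral>x. h x \<partial>distr N borel e) = (\<integral>\<omega>. h (X \<omega>) \<partial>M) - G 0"
    by (simp add: integral_distr G_def)
  also have "\<dots> = (\<integral>\<omega>. G (X \<omega>) - G 0 \<partial>M) - (\<integral>\<omega>. D (X \<omega>) \<partial>M)"
    unfolding D_def using int_hX int_GX by (simp add: M.prob_space)
  also have "\<dots> = m * (\<integral>\<omega>. D (Xe \<omega>) \<partial>M) - (\<integral>\<omega>. D (X \<omega>) \<partial>M)"
    using stein \<open>0 < m\<close> by simp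
  \<comment> \<open>Splitting \<open>m = (m - 1) + 1\<close> separates the error in the mean from
    the coupling error.\<close>
  also have "\<dots> = (m - 1) * (\<integral>\<omega>. D (Xe \<omega>) \<partial>M) - (\<integral>\<omega>. D (X \<omega>) - D (Xe \<omega>) \<partial>M)"
    using int_DX int_DXe by (simp add: algebra_simps)
  finally have "\<bar>(\<integral>x. h x \<partial>distr M borel X) - (\<integral>x. h x \<partial>distr N borel e)\<bar>
      \<le> \<bar>m - 1\<bar> * \<bar>\<integral>\<omega>. D (Xe \<omega>) \<partial>M\<bar> + \<bar>\<integral>\<omega>. D (X \<omega>) - D (Xe \<omega>) \<partial>M\<bar>"
    by (metis abs_mult abs_triangle_ineq4)
  moreover have "\<bar>\<integral>\<omega>. D (Xe \<omega>) \<partial>M\<bar> \<le> 1"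
  proof -
    have "\<bar>\<integral>\<omega>. D (Xe \<omega>) \<partial>M\<bar> \<le> (\<integral>\<omega>. \<bar>D (Xe \<omega>)\<bar> \<partial>M)"
      by (rule integral_abs_bound)
    also have "\<dots> \<le> (\<integral>\<omega>. 1 \<partial>M)"
      using int_DXe D_bound by (intro integral_mono) auto
    finally show ?thesis
      by (simp add: M.prob_space)
  qed
  moreover have "\<bar>\<integral>\<omega>. D (X \<omega>) - D (Xe \<omega>) \<partial>M\<bar> \<le> 2 * (\<integral>\<omega>. \<bar>X \<omega> - Xe \<omega>\<bar> \<partial>M)"
  proof -
    have "\<bar>\<integral>\<omega>. D (X \<omega>) - D (Xe \<omega>) \<partial>M\<bar> \<le> (\<integral>\<omega>. \<bar>D (X \<omega>) - D (Xe \<omega>)\<bar> \<partial>M)"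
      by (rule integral_abs_bound)
    also have "\<dots> \<le> (\<integral>\<omega>. 2 * \<bar>X \<omega> - Xe \<omega>\<bar> \<partial>M)"
      using int_DX int_DXe assms(4) int_Xe D_lip by (intro integral_mono) auto
    finally show ?thesis
      by simp
  qed
  ultimately show "\<bar>(\<integral>x. h x \<partial>distr M borel X) - (\<integral>x. h x \<partial>distr N borel e)\<bar>
      \<le> 2 * (\<integral>\<omega>. \<bar>X \<omega> - Xe \<omega>\<bar> \<partial>M) + \<bar>m - 1\<bar>"
    using mult_left_mono[of "\<bar>\<integral>\<omega>. D (Xe \<omega>) \<partial>M\<bar>" 1 "\<bar>m - 1\<bar>"] by simp
qed

end
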